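(* Let $G$ be a nontrivial subgroup of $(\mathbb{Q},+)$, let $k\ge1$, and let $\chi\colon\mathcal{P}_k\to\{\mathsf{F},\infty\}$ be a binary intersection configuration of size $k$. Then $\chi$ is realizable in $G$ if and only if the following conditions hold: (i) $\chi$ is decreasing, i.e. for all $I,J\in\mathcal{P}_k$, $I\subseteq J$ implies $\chi(I)\ge\chi(J)$, where $\mathsf{F}<\infty$; (ii) if $G$ has finite support then $|\mathcal{M}_\infty(\chi)|\le|\operatorname{supp}_{-\infty}(G)|$.
   Context: $\mathcal{P}_k$ is the set of nonempty subsets of $[k]=\{1,\dots,k\}$, ordered by inclusion. A binary intersection configuration of size $k\ge1$ is a map $\chi\colon\mathcal{P}_k\to\{\mathsf{F},\infty\}$, where $\mathsf{F}<\infty$ are two formal symbols. $\chi$ is realizable in a group $G$ if there exist subgroups $H_1,\dots,H_k\leqslant G$ such that, for every $I\in\mathcal{P}_k$, the intersection $\bigcap_{i\in I}H_i$ is finitely generated if $\chi(I)=\mathsf{F}$ and not finitely generated if $\chi(I)=\infty$. $\mathcal{M}_\infty(\chi)$ is the set of inclusion-maximal elements of $\chi^{-1}(\infty)$. For a nontrivial subgroup $G\leqslant\mathbb{Q}$ and a prime $p$, let $\operatorname{lgcd}_p(G)\in\mathbb{Z}\cup\{-\infty\}$ be the infimum of the $p$-adic valuations of the nonzero elements of $G$. $G$ has finite support if $\{p \text{ prime}:\operatorname{lgcd}_p(G)\ne0\}$ is finite, and $\operatorname{supp}_{-\infty}(G)=\{p\text{ prime}:\operatorname{lgcd}_p(G)=-\infty\}$.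 *)

theory Defs
  imports
    "HOL-Library.Extended_Real"
    "HOL-Computational_Algebra.Primes"
    "HOL-Algebra.Generated_Groups"
begin

section \<open>Binary intersection configurations\<close>

datatype fin_symbol = FG | INFTY

instantiation fin_symbol :: linorder
begin

definition less_eq_fin_symbol :: "fin_symbol \<Rightarrow> fin_symbol \<Rightarrow> bool" where
  "less_eq_fin_symbol a b \<longleftrightarrow> a = FG \<or> b = INFTY"

definition less_fin_symbol :: "fin_symbol \<Rightarrow> fin_symbol \<Rightarrow> bool" where
  "less_fin_symbol a b \<longleftrightarrow> a = FG \<and> b = INFTY"

instance
proof
  fix x y z :: fin_symbol
  show "x < y \<longleftrightarrow> x \<le> y \<and> \<not> y \<le> x"
    by (cases x; cases y) (simp_all add: less_eq_fin_symbol_def less_fin_symbol_def)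
  show "x \<le> x"
    by (cases x) (simp_all add: less_eq_fin_symbol_def)
  show "x \<le> y \<Longrightarrow> y \<le> z \<Longrightarrow> x \<le> z"
    by (cases x; cases y; cases z) (simp_all add: less_eq_fin_symbol_def)
  show "x \<le> y \<Longrightarrow> y \<le> x \<Longrightarrow> x = y"
    by (cases x; cases y) (simp_all add: less_eq_fin_symbol_def)
  show "x \<le> y \<or> y \<le> x"
    by (cases x; cases y) (simp_all add: less_eq_fin_symbol_def)
qed

end

definition nonempty_subsets :: "nat \<Rightarrow> nat set set" where
  "nonempty_subsets k = {I. I \<subseteq> {1..k} \<and> I \<noteq> {}}"

text \<open>
  A configuration of size \<open>k\<close> is a total function on \<open>nat set\<close>; every notion below only
  inspects its values on \<open>nonempty_subsets k\<close>.
\<close>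

type_synonym config = "nat set \<Rightarrow> fin_symbol"

definition finitely_generated :: "('a, 'b) monoid_scheme \<Rightarrow> 'a set \<Rightarrow> bool" where
  "finitely_generated G H \<longleftrightarrow> (\<exists>S. finite S \<and> S \<subseteq> H \<and> generate G S = H)"

definition realizable :: "('a, 'b) monoid_scheme \<Rightarrow> nat \<Rightarrow> config \<Rightarrow> bool" where
  "realizable G k \<chi> \<longleftrightarrow>
    (\<exists>H :: nat \<Rightarrow> 'a set.
      (\<forall>i\<in>{1..k}. subgroup (H i) G) \<and>
      (\<forall>I\<in>nonempty_subsets k.
        (\<chi> I = FG \<longrightarrow> finitely_generated G (\<Inter>i\<in>I. H i)) \<and>
        (\<chi> I = INFTY \<longrightarrow> \<not> finitely_generated G (\<Inter>i\<in>I. H i))))"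

definition decreasing :: "nat \<Rightarrow> config \<Rightarrow> bool" where
  "decreasing k \<chi> \<longleftrightarrow>
    (\<forall>I\<in>nonempty_subsets k. \<forall>J\<in>nonempty_subsets k. I \<subseteq> J \<longrightarrow> \<chi> I \<ge> \<chi> J)"

definition max_infty :: "nat \<Rightarrow> config \<Rightarrow> nat set set" where
  "max_infty k \<chi> =
    {I \<in> nonempty_subsets k. \<chi> I = INFTY \<and>
      (\<forall>J\<in>nonempty_subsets k. \<chi> J = INFTY \<longrightarrow> I \<subseteq> J \<longrightarrow> J = I)}"

section \<open>Subgroups of the additive group of the rationals\<close>

definition rational_group :: "rat monoid" where
  "rational_group = \<lparr>carrier = UNIV, mult = (+), one = 0\<rparr>"

lemma group_rational_group: "group rational_group"
proof (rule groupI)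
  fix x assume "x \<in> carrier rational_group"
  show "\<exists>y\<in>carrier rational_group. y \<otimes>\<^bsub>rational_group\<^esub> x = \<one>\<^bsub>rational_group\<^esub>"
    by (rule bexI[of _ "- x"]) (simp_all add: rational_group_def)
qed (simp_all add: rational_group_def)

text \<open>Only meaningful for \<open>x \<noteq> 0\<close>; \<open>quotient_of x\<close> is \<open>x\<close> in lowest terms.\<close>

definition padic_val :: "nat \<Rightarrow> rat \<Rightarrow> int" where
  "padic_val p x =
    int (multiplicity (int p) (fst (quotient_of x))) -
    int (multiplicity (int p) (snd (quotient_of x)))"

text \<open>
  The infimum is taken in the extended reals. A nonempty set of integers has its infimum
  in \<open>\<int> \<union> {-\<infinity>}\<close>, so for \<open>G \<noteq> {0}\<close> nothing else occurs.
\<close>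

definition lgcd :: "nat \<Rightarrow> rat set \<Rightarrow> ereal" where
  "lgcd p G = (INF x\<in>G - {0}. ereal (real_of_int (padic_val p x)))"

definition finite_support :: "rat set \<Rightarrow> bool" where
  "finite_support G \<longleftrightarrow> finite {p :: nat. prime p \<and> lgcd p G \<noteq> 0}"

definition supp_minf :: "rat set \<Rightarrow> nat set" where
  "supp_minf G = {p :: nat. prime p \<and> lgcd p G = - \<infinity>}"

end

theory Submission
  imports Defs "HOL-Library.Countable_Set"
begin

text \<open>
  For a nonzero \<open>x\<close> in a subgroup \<open>H\<close> of the rationals, \<open>H\<close> is finitely generated iff only
  finitely many \<open>d > 0\<close> satisfy \<open>x / d \<in> H\<close>. If \<open>G\<close> has finite support, a subgroup that is not
  finitely generated therefore contains all \<open>x / p ^ n\<close> for some prime \<open>p\<close>. Two distinct maximal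
  \<open>\<infinity>\<close>-sets \<open>I\<close> and \<open>J\<close> cannot share such a prime, since otherwise the intersection over
  \<open>I \<union> J\<close> would not be finitely generated; this gives an injection into the primes of infinite
  divisibility of \<open>G\<close>. Conversely, attach to the maximal \<open>\<infinity>\<close>-sets \<open>K\<close> pairwise disjoint sets \<open>Q K\<close>
  of primes, either one prime of infinite divisibility each, or infinitely many primes \<open>p\<close> with
  \<open>x / p \<in> G\<close> each, and let \<open>H\<^sub>i\<close> consist of the \<open>y \<in> G\<close> for which the denominator of \<open>y / x\<close> only
  involves primes from the sets \<open>Q K\<close> with \<open>i \<in> K\<close>.
\<close>

section \<open>Denominators\<close>

text \<open>The conversion by \<open>nat\<close> loses nothing, since \<open>quotient_of\<close>
  returns a positive denominator. Natural numbers suit the later arguments on prime factors.\<close>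

definition denom :: "rat \<Rightarrow> nat" where
  "denom q = nat (snd (quotient_of q))"

lemma denom_pos: "denom q > 0"
  using quotient_of_denom_pos'[of q] by (simp add: denom_def)

lemma denom_quotient:
  obtains a :: int where "q = of_int a / of_nat (denom q)" "coprime a (int (denom q))"
proof -
  obtain a b where ab: "quotient_of q = (a, b)" by fastforce
  then have "b > 0" by (rule quotient_of_denom_pos)
  moreover have "q = of_int a / of_int b" "coprime a b"
    using ab quotient_of_div quotient_of_coprime by blast+
  ultimately show thesis
    using that[of a] ab by (simp add: denom_def)
qed

text \<open>Since numerator and denominator are coprime, a factor clearing the fraction must absorb
  the whole denominator. Divisibility questions about \<open>denom\<close> thereby become
  integrality questions.\<close>

lemma denom_dvd_iff: "denom q dvd n \<longleftrightarrow> of_nat n * q \<in> \<int>"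
proof -
  obtain a where q: "q = of_int a / of_nat (denom q)" and co: "coprime a (int (denom q))"
    by (rule denom_quotient)
  have d: "(of_nat (denom q) :: rat) \<noteq> 0"
    using denom_pos[of q] by simp
  show ?thesis
  proof
    assume "denom q dvd n"
    then obtain m where m: "n = denom q * m" ..
    have "of_nat n * q = of_int (int m * a)"
      by (subst q) (use d in \<open>simp add: m\<close>)
    then show "of_nat n * q \<in> \<int>" by (metis Ints_of_int)
  next
    assume "of_nat n * q \<in> \<int>"
    then obtain z where z: "of_nat n * q = of_int z" by (elim Ints_cases)
    have "of_nat n * q = of_int (int n * a) / of_nat (denom q)"
      by (subst q) simp
    with z d have "of_int (int n * a) = (of_int (z * int (denom q)) :: rat)"
      by (simp add: field_simps)
    then have "int n * a = z * int (denom q)" by (simp only: of_int_eq_iff)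
    then have "int (denom q) dvd int n * a" by simp
    with co have "int (denom q) dvd int n"
      by (metis coprime_commute coprime_dvd_mult_left_iff)
    then show "denom q dvd n" by simp
  qed
qed

lemma denom_0 [simp]: "denom 0 = 1"
  by (simp add: denom_def)

lemma denom_1 [simp]: "denom 1 = 1"
  by (simp add: denom_def)

lemma of_nat_denom_mult_in_Ints: "of_nat (denom q) * q \<in> \<int>"
  using denom_dvd_iff[of q "denom q"] by simp

text \<open>The product of the two denominators clears both fractions. Hence a difference has no new
  primes in its denominator, which makes \<open>localized_at\<close> a subgroup.\<close>

lemma denom_diff_dvd: "denom (q - r) dvd denom q * denom r"
proof -
  have "of_nat (denom q * denom r) * (q - r) =
      of_nat (denom r) * (of_nat (denom q) * q) - of_nat (denom q) * (of_nat (denom r) * r)"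
    by (simp add: algebra_simps)
  also have "\<dots> \<in> \<int>"
    by (intro Ints_diff Ints_mult of_nat_denom_mult_in_Ints Ints_of_nat)
  finally show ?thesis by (simp only: denom_dvd_iff)
qed

lemma denom_inverse_of_nat:
  assumes "n > 0"
  shows "denom (1 / of_nat n) = n"
proof (rule dvd_antisym)
  show "denom (1 / of_nat n) dvd n"
    using assms by (simp add: denom_dvd_iff)
next
  obtain z where "of_nat (denom (1 / of_nat n)) * (1 / of_nat n :: rat) = of_int z"
    by (rule Ints_cases[OF of_nat_denom_mult_in_Ints])
  with assms have "of_nat (denom (1 / of_nat n)) = (of_int (z * int n) :: rat)"
    by (simp add: field_simps)
  then have "int (denom (1 / of_nat n)) = z * int n"
    by (metis of_int_eq_iff of_int_of_nat_eq)
  then show "n dvd denom (1 / of_nat n)"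
    by (metis dvd_triv_right int_dvd_int_iff)
qed

section \<open>Subgroups of the rationals\<close>

lemma inv_rational_group [simp]: "inv\<^bsub>rational_group\<^esub> x = - x"
  by (rule group.inv_equality[OF group_rational_group]) (auto simp: rational_group_def)

lemma subgroup_rational_group_iff:
  "subgroup H rational_group \<longleftrightarrow> 0 \<in> H \<and> (\<forall>x\<in>H. \<forall>y\<in>H. x - y \<in> H)" (is "?L \<longleftrightarrow> ?R")
proof
  assume H: ?L
  have zero: "0 \<in> H"
    using subgroup.one_closed[OF H] by (simp add: rational_group_def)
  have "x - y \<in> H" if "x \<in> H" "y \<in> H" for x y
    using subgroup.m_closed[OF H that(1) subgroup.m_inv_closed[OF H that(2)]]
    by (simp, simp add: rational_group_def)
  with zero show ?R by blast
next
  assume R: ?R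
  then have minus: "- x \<in> H" if "x \<in> H" for x
    using that by (metis diff_0)
  have add: "x + y \<in> H" if "x \<in> H" "y \<in> H" for x y
    using R minus that by (metis diff_minus_eq_add)
  show ?L
  proof
    show "inv\<^bsub>rational_group\<^esub> x \<in> H" if "x \<in> H" for x
      using minus[OF that] by simp
  qed (use R add in \<open>auto simp: rational_group_def\<close>)
qed

lemma
  assumes H: "subgroup H rational_group"
  shows subgroup_zero: "0 \<in> H"
    and subgroup_diff: "\<And>x y. x \<in> H \<Longrightarrow> y \<in> H \<Longrightarrow> x - y \<in> H"
    and subgroup_minus: "\<And>x. x \<in> H \<Longrightarrow> - x \<in> H"
    and subgroup_add: "\<And>x y. x \<in> H \<Longrightarrow> y \<in> H \<Longrightarrow> x + y \<in> H"
proof -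
  show 0: "0 \<in> H" and D: "\<And>x y. x \<in> H \<Longrightarrow> y \<in> H \<Longrightarrow> x - y \<in> H"
    using H by (auto simp: subgroup_rational_group_iff)
  show M: "- x \<in> H" if "x \<in> H" for x
    using D[OF 0 that] by simp
  show "x + y \<in> H" if "x \<in> H" "y \<in> H" for x y
    using D[OF that(1) M[OF that(2)]] by simp
qed

lemma subgroup_of_int_mult:
  assumes H: "subgroup H rational_group" and x: "x \<in> H"
  shows "of_int a * x \<in> H"
proof -
  have nat: "of_nat n * x \<in> H" for n
    by (induction n) (auto simp: distrib_right intro: subgroup_zero[OF H] subgroup_add[OF H x])
  show ?thesis
  proof (cases "a \<ge> 0")
    case True
    then show ?thesis using nat[of "nat a"] by simp
  next
    case False
    then show ?thesis using subgroup_minus[OF H nat[of "nat (- a)"]] by simp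
  qed
qed

lemma subgroup_of_nat_mult:
  assumes "subgroup H rational_group" "x \<in> H"
  shows "of_nat n * x \<in> H"
  using subgroup_of_int_mult[OF assms, of "int n"] by simp

lemma subgroup_div_dvd:
  assumes H: "subgroup H rational_group" and x: "x / of_nat d \<in> H" and d: "e dvd d" "d > 0"
  shows "x / of_nat e \<in> H"
proof -
  obtain m where "d = e * m" using d by blast
  with d have "x / of_nat e = of_nat m * (x / of_nat d)" by auto
  then show ?thesis using subgroup_of_nat_mult[OF H x] by metis
qed

text \<open>Bezout: if \<open>y / x = a / d\<close> in lowest terms, then \<open>u a + v d = 1\<close> gives \<open>u y + v x = x / d\<close>.\<close>

lemma subgroup_div_denom:
  assumes H: "subgroup H rational_group" and x: "x \<in> H" "x \<noteq> 0" and y: "y \<in> H"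
  shows "x / of_nat (denom (y / x)) \<in> H"
proof -
  define d where "d = denom (y / x)"
  obtain a where a: "y / x = of_int a / of_nat d" "coprime a (int d)"
    unfolding d_def by (rule denom_quotient)
  then obtain u v where uv: "u * a + v * int d = 1"
    by (metis bezout_int coprime_imp_gcd_eq_1)
  have d: "(of_nat d :: rat) \<noteq> 0" using denom_pos[of "y / x"] by (simp add: d_def)
  have "of_int u * y + of_int v * x = x * of_int (u * a + v * int d) / of_nat d"
    using a(1) x d by (simp add: field_simps)
  then have "x / of_nat d = of_int u * y + of_int v * x"
    unfolding uv by simp
  then show ?thesis
    unfolding d_def[symmetric]
    using subgroup_add[OF H subgroup_of_int_mult[OF H y] subgroup_of_int_mult[OF H x(1)]] by metis
qed

lemma subgroup_rational_Inter:
  assumes "\<And>i. i \<in> I \<Longrightarrow> subgroup (H i) rational_group"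
  shows "subgroup (\<Inter>i\<in>I. H i) rational_group"
  using assms by (auto simp: subgroup_rational_group_iff)

section \<open>Finite generation\<close>

text \<open>Measures how far a subgroup \<open>H\<close> extends beyond the integer multiples of a
  nonzero base point \<open>x\<close> in \<open>H\<close>: each \<open>y\<close> in \<open>H\<close>
  is an integer multiple of \<open>x / d\<close> with \<open>d = denom (y / x)\<close> in this
  set.\<close>

definition divisors_at :: "rat set \<Rightarrow> rat \<Rightarrow> nat set" where
  "divisors_at H x = {d. d > 0 \<and> x / of_nat d \<in> H}"

lemma divisors_at_mono: "H \<subseteq> K \<Longrightarrow> divisors_at H x \<subseteq> divisors_at K x"
  by (auto simp: divisors_at_def)

lemma finite_set_common_denom:
  assumes "finite (S :: rat set)"
  shows "\<exists>N>0. \<forall>s\<in>S. of_nat N * s \<in> \<int>"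
proof (intro exI[of _ "\<Prod>s\<in>S. denom s"] conjI ballI)
  show "(\<Prod>s\<in>S. denom s) > 0" by (simp add: denom_pos prod_pos)
  show "of_nat (\<Prod>s\<in>S. denom s) * s \<in> \<int>" if "s \<in> S" for s
    using assms that by (simp only: denom_dvd_iff[symmetric]) (simp add: dvd_prodI)
qed

text \<open>Finitely many generators, divided by \<open>x\<close>, have a common denominator
  \<open>N\<close>, and every \<open>d\<close> in the set then divides \<open>N\<close>. Conversely,
  the elements \<open>x / d\<close> always generate \<open>H\<close>, by
  \<open>subgroup_div_denom\<close>.\<close>

lemma finitely_generated_iff:
  assumes H: "subgroup H rational_group" and x: "x \<in> H" "x \<noteq> 0"
  shows "finitely_generated rational_group H \<longleftrightarrow> finite (divisors_at H x)"
proof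
  assume "finitely_generated rational_group H"
  then obtain S where S: "finite S" "generate rational_group S = H"
    unfolding finitely_generated_def by blast
  obtain N where N: "N > 0" "\<forall>s\<in>(\<lambda>s. s / x) ` S. of_nat N * s \<in> \<int>"
    using finite_set_common_denom[of "(\<lambda>s. s / x) ` S"] S by blast
  have int: "of_nat N * (y / x) \<in> \<int>" if "y \<in> generate rational_group S" for y
    using that
  proof induction
    case (eng a b)
    then show ?case
      using Ints_add[OF eng.IH] by (simp add: rational_group_def add_divide_distrib distrib_left)
  next
    case (inv h)
    then show ?case
      using N(2) Ints_minus[of "of_nat N * (h / x)"] by simp
  qed (use N in \<open>auto simp: rational_group_def\<close>)
  have "divisors_at H x \<subseteq> {d. d dvd N}"
  proof clarify
    fix d assume d: "d \<in> divisors_at H x"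
    then have "of_nat N * (1 / of_nat d :: rat) \<in> \<int>"
      using int[of "x / of_nat d"] x S by (simp add: divisors_at_def)
    then show "d dvd N"
      using d denom_inverse_of_nat[of d] unfolding denom_dvd_iff[symmetric] divisors_at_def by simp
  qed
  with N(1) show "finite (divisors_at H x)"
    using finite_subset finite_divisors_nat by blast
next
  assume fin: "finite (divisors_at H x)"
  let ?S = "(\<lambda>d. x / of_nat d) ` divisors_at H x"
  have sub: "?S \<subseteq> H" by (auto simp: divisors_at_def)
  have gen: "subgroup (generate rational_group ?S) rational_group"
    by (rule group.generate_is_subgroup[OF group_rational_group]) (simp add: rational_group_def)
  have "y \<in> generate rational_group ?S" if y: "y \<in> H" for y
  proof -
    define d where "d = denom (y / x)"
    obtain a where a: "y / x = of_int a / of_nat d"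
      unfolding d_def by (rule denom_quotient)
    have "d \<in> divisors_at H x"
      using subgroup_div_denom[OF H x y] denom_pos by (simp add: divisors_at_def d_def)
    then have "x / of_nat d \<in> generate rational_group ?S"
      by (intro generate.incl imageI)
    moreover have "y = of_int a * (x / of_nat d)"
      using a x by (simp add: field_simps)
    ultimately show ?thesis using subgroup_of_int_mult[OF gen] by metis
  qed
  moreover have "generate rational_group ?S \<subseteq> H"
    using group.generate_subgroup_incl[OF group_rational_group sub H] .
  ultimately have "generate rational_group ?S = H" by blast
  with fin sub show "finitely_generated rational_group H"
    unfolding finitely_generated_def by blast
qed

lemma finitely_generated_zero: "finitely_generated rational_group {0}"
  unfolding finitely_generated_def
proof (intro exI[of _ "{}"] conjI)
  show "generate rational_group {} = {0}"
    using group.generate_empty[OF group_rational_group] by (simp add: rational_group_def)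
qed auto

text \<open>One base point \<open>x\<close> in \<open>H\<close> serves both groups, and the divisor
  set of \<open>H\<close> lies in that of \<open>K\<close>. This is the source of condition
  (i).\<close>

lemma finitely_generated_subgroup:
  assumes H: "subgroup H rational_group" and K: "subgroup K rational_group"
    and "H \<subseteq> K" and fg: "finitely_generated rational_group K"
  shows "finitely_generated rational_group H"
proof (cases "H = {0}")
  case True
  then show ?thesis using finitely_generated_zero by simp
next
  case False
  then obtain x where x: "x \<in> H" "x \<noteq> 0" using subgroup_zero[OF H] by blast
  with \<open>H \<subseteq> K\<close> have "finite (divisors_at K x)"
    using finitely_generated_iff[OF K, of x] fg by blast
  then have "finite (divisors_at H x)"
    using divisors_at_mono[OF \<open>H \<subseteq> K\<close>] finite_subset by blast
  then show ?thesis using finitely_generated_iff[OF H x] by simp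
qed

text \<open>Generation does not depend on the ambient carrier, so the rest of the argument can take
  place in \<open>rational_group\<close>.\<close>

lemma finitely_generated_carrier_update:
  assumes "subgroup G rational_group" "H \<subseteq> G"
  shows "finitely_generated (rational_group\<lparr>carrier := G\<rparr>) H \<longleftrightarrow> finitely_generated rational_group H"
  unfolding finitely_generated_def
  using group.generate_consistent[OF group_rational_group _ assms(1)] assms(2)
  by (metis order_trans)

lemma subgroup_carrier_update_iff:
  assumes "subgroup G rational_group"
  shows "subgroup H (rational_group\<lparr>carrier := G\<rparr>) \<longleftrightarrow> subgroup H rational_group \<and> H \<subseteq> G"
proof
  assume H: "subgroup H (rational_group\<lparr>carrier := G\<rparr>)"
  show "subgroup H rational_group \<and> H \<subseteq> G"
    using group.incl_subgroup[OF group_rational_group assms H] subgroup.subset[OF H] by simp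
next
  assume "subgroup H rational_group \<and> H \<subseteq> G"
  then show "subgroup H (rational_group\<lparr>carrier := G\<rparr>)"
    using group.subgroup_incl[OF group_rational_group _ assms] by blast
qed

section \<open>Infinite divisor sets and prime powers\<close>

lemma infinite_divisors_at_powers:
  assumes "prime p" "\<And>n. x / of_nat (p ^ n) \<in> H"
  shows "infinite (divisors_at H x)"
proof -
  have "inj (\<lambda>n. p ^ n)"
    using prime_gt_1_nat[OF assms(1)] by (simp add: inj_on_def)
  then have "infinite (range (\<lambda>n. p ^ n))"
    by (simp add: finite_image_iff)
  moreover have "range (\<lambda>n. p ^ n) \<subseteq> divisors_at H x"
    using assms prime_gt_0_nat[OF assms(1)] by (auto simp: divisors_at_def)
  ultimately show ?thesis using finite_subset by blast
qed

text \<open>Otherwise the \<open>p\<close>-exponents of the divisors would be bounded for every prime \<open>p\<close> and zero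
  for almost all of them.\<close>

lemma infinite_divisors_at_imp_prime:
  assumes H: "subgroup H rational_group" and inf: "infinite (divisors_at H x)"
    and fin: "finite {p. prime p \<and> x / of_nat p \<in> H}"
  shows "\<exists>p. prime p \<and> (\<forall>n. x / of_nat (p ^ n) \<in> H)"
proof (rule ccontr)
  assume "\<not> ?thesis"
  then obtain e where e: "\<And>p. prime p \<Longrightarrow> x / of_nat (p ^ e p) \<notin> H" by metis
  define B where "B = {p. prime p \<and> x / of_nat p \<in> H}"
  \<comment> \<open>A common multiple of all divisors: only primes in the finite set
    \<open>B\<close> can occur in a divisor, and \<open>p\<close> occurs with exponent below
    \<open>e p\<close>.\<close>
  define N where "N = (\<Prod>p\<in>B. p ^ e p)"
  have "d dvd N" if "d \<in> divisors_at H x" for d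
  proof (rule multiplicity_le_imp_dvd)
    have d: "d > 0" "x / of_nat d \<in> H" using that by (auto simp: divisors_at_def)
    show "d \<noteq> 0" using d by simp
    fix p :: nat assume p: "prime p"
    have dvd: "x / of_nat f \<in> H" if "f dvd d" for f
      using subgroup_div_dvd[OF H d(2) that d(1)] .
    have "\<not> p ^ e p dvd d" using dvd e[OF p] by blast
    then have le: "multiplicity p d < e p"
      using p d by (metis multiplicity_dvd' not_less)
    show "multiplicity p d \<le> multiplicity p N"
    proof (cases "p \<in> B")
      case True
      have "multiplicity p N = e p"
        unfolding N_def using True p fin
        by (subst multiplicity_prod_prime_powers) (auto simp: B_def)
      with le show ?thesis by simp
    next
      case False
      then have "\<not> p dvd d" using dvd p by (auto simp: B_def)
      then show ?thesis by (simp add: not_dvd_imp_multiplicity_0)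
    qed
  qed
  moreover have "N > 0"
    unfolding N_def by (rule prod_pos) (auto simp: B_def prime_gt_0_nat)
  ultimately have "finite (divisors_at H x)"
    using finite_subset[of "divisors_at H x" "{d. d dvd N}"] finite_divisors_nat by blast
  with inf show False by contradiction
qed

section \<open>Valuations\<close>

text \<open>The fraction need not be in lowest terms: cross-multiplying with the reduced form and
  using additivity of multiplicities gives the same difference.\<close>

lemma padic_val_quotient:
  assumes p: "prime p" and "a \<noteq> 0" "b \<noteq> 0"
  shows "padic_val p (of_int a / of_int b) = int (multiplicity (int p) a) - int (multiplicity (int p) b)"
proof -
  obtain c d where cd: "quotient_of (of_int a / of_int b) = (c, d)" by fastforce
  have d: "d > 0" using quotient_of_denom_pos[OF cd] .
  have eq: "(of_int a / of_int b :: rat) = of_int c / of_int d" using quotient_of_div[OF cd] .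
  then have c: "c \<noteq> 0" using assms d by auto
  from eq have "(of_int (a * d) :: rat) = of_int (c * b)"
    using assms d by (simp add: field_simps)
  then have "a * d = c * b" by (simp only: of_int_eq_iff)
  then have "multiplicity (int p) (a * d) = multiplicity (int p) (c * b)" by simp
  moreover have "prime_elem (int p)" using p by simp
  ultimately have "multiplicity (int p) a + multiplicity (int p) d =
      multiplicity (int p) c + multiplicity (int p) b"
    using assms c d by (simp add: prime_elem_multiplicity_mult_distrib)
  then show ?thesis by (simp add: padic_val_def cd)
qed

lemma padic_val_mult:
  assumes p: "prime p" and "x \<noteq> 0" "y \<noteq> 0"
  shows "padic_val p (x * y) = padic_val p x + padic_val p y"
proof -
  obtain a b where x: "x = of_int a / of_int b" "b > 0"
    by (metis quotient_of_div quotient_of_denom_pos surj_pair)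
  obtain c d where y: "y = of_int c / of_int d" "d > 0"
    by (metis quotient_of_div quotient_of_denom_pos surj_pair)
  have nz: "a \<noteq> 0" "b \<noteq> 0" "c \<noteq> 0" "d \<noteq> 0" using x y assms by auto
  have "x * y = of_int (a * c) / of_int (b * d)" using x y by simp
  then have "padic_val p (x * y) =
      int (multiplicity (int p) (a * c)) - int (multiplicity (int p) (b * d))"
    using nz padic_val_quotient[OF p, of "a * c" "b * d"] by simp
  then show ?thesis
    using nz p unfolding x(1) y(1)
    by (simp add: padic_val_quotient prime_elem_multiplicity_mult_distrib)
qed

lemma padic_val_prime_power:
  assumes "prime p"
  shows "padic_val p (1 / of_nat (p ^ n)) = - int n"
proof -
  have "prime_elem (int p)" using assms by simp
  then show ?thesis
    using padic_val_quotient[OF assms, of 1 "int p ^ n"] assms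
    by (simp add: multiplicity_unit_right)
qed

lemma finite_padic_val_nonzero:
  assumes "x \<noteq> 0"
  shows "finite {p. prime p \<and> padic_val p x \<noteq> 0}"
proof -
  obtain a b where ab: "quotient_of x = (a, b)" by fastforce
  have b: "b \<noteq> 0" using quotient_of_denom_pos[OF ab] by simp
  have a: "a \<noteq> 0" using quotient_of_div[OF ab] assms by auto
  have "{p. prime p \<and> padic_val p x \<noteq> 0} \<subseteq> {p. p dvd nat \<bar>a * b\<bar>}"
  proof clarify
    fix p assume p: "prime p" "padic_val p x \<noteq> 0"
    then have "multiplicity (int p) a \<noteq> 0 \<or> multiplicity (int p) b \<noteq> 0"
      by (auto simp: padic_val_def ab)
    then have "int p dvd a \<or> int p dvd b"
      by (metis not_dvd_imp_multiplicity_0)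
    then have "int p dvd \<bar>a * b\<bar>" by auto
    then show "p dvd nat \<bar>a * b\<bar>" by (simp add: nat_dvd_iff int_dvd_int_iff dvd_nat_abs_iff)
  qed
  moreover have "nat \<bar>a * b\<bar> > 0" using a b by simp
  ultimately show ?thesis
    using finite_subset finite_divisors_nat by blast
qed

text \<open>If \<open>y\<close> has valuation at least \<open>n\<close> below that of
  \<open>x\<close>, then \<open>p ^ n\<close> divides the denominator \<open>d\<close> of
  \<open>y / x\<close>, and \<open>x / d\<close> is in \<open>H\<close> by Bezout. This translates
  statements on \<open>lgcd\<close> into divisibility of a fixed \<open>x\<close>.\<close>

lemma div_prime_power_in_subgroup_iff:
  assumes H: "subgroup H rational_group" and x: "x \<in> H" "x \<noteq> 0" and p: "prime p"
  shows "x / of_nat (p ^ n) \<in> H \<longleftrightarrow> (\<exists>y\<in>H - {0}. padic_val p y \<le> padic_val p x - int n)"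
proof
  have p0: "p > 0" using p by (rule prime_gt_0_nat)
  assume "x / of_nat (p ^ n) \<in> H"
  moreover have "padic_val p (x * (1 / of_nat (p ^ n))) = padic_val p x - int n"
    using x p0 padic_val_mult[OF p, of x "1 / of_nat (p ^ n)"] padic_val_prime_power[OF p, of n]
    by simp
  ultimately show "\<exists>y\<in>H - {0}. padic_val p y \<le> padic_val p x - int n"
    using x p0 by (intro bexI[of _ "x / of_nat (p ^ n)"]) auto
next
  assume "\<exists>y\<in>H - {0}. padic_val p y \<le> padic_val p x - int n"
  then obtain y where y: "y \<in> H" "y \<noteq> 0" "padic_val p y \<le> padic_val p x - int n" by blast
  define d where "d = denom (y / x)"
  have d: "d > 0" by (simp add: d_def denom_pos)
  obtain a where a: "y / x = of_int a / of_nat d"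
    unfolding d_def by (rule denom_quotient)
  then have a0: "a \<noteq> 0" using x y by auto
  have "padic_val p y = padic_val p x + padic_val p (y / x)"
    using padic_val_mult[OF p, of x "y / x"] x y by simp
  moreover have "padic_val p (y / x) =
      int (multiplicity (int p) a) - int (multiplicity (int p) (int d))"
    using padic_val_quotient[OF p a0, of "int d"] a d by simp
  ultimately have "n \<le> multiplicity (int p) (int d)" using y by simp
  then have "int p ^ n dvd int d" by (rule multiplicity_dvd')
  then have "p ^ n dvd d" by (metis int_dvd_int_iff of_nat_power)
  moreover have "x / of_nat d \<in> H"
    unfolding d_def by (rule subgroup_div_denom[OF H x y(1)])
  ultimately show "x / of_nat (p ^ n) \<in> H"
    using subgroup_div_dvd[OF H _ _ d] by blast
qed

lemma lgcd_eq_minf_iff: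
  assumes H: "subgroup H rational_group" and x: "x \<in> H" "x \<noteq> 0" and p: "prime p"
  shows "lgcd p H = - \<infinity> \<longleftrightarrow> (\<forall>n. x / of_nat (p ^ n) \<in> H)"
proof
  assume lgcd: "lgcd p H = - \<infinity>"
  show "\<forall>n. x / of_nat (p ^ n) \<in> H"
  proof
    fix n
    have "lgcd p H < ereal (real_of_int (padic_val p x - int n))" by (simp add: lgcd)
    then obtain y where "y \<in> H - {0}" "real_of_int (padic_val p y) < real_of_int (padic_val p x - int n)"
      unfolding lgcd_def INF_less_iff by auto
    then show "x / of_nat (p ^ n) \<in> H"
      by (subst div_prime_power_in_subgroup_iff[OF assms])
        (metis of_int_less_iff less_imp_le)
  qed
next
  assume all: "\<forall>n. x / of_nat (p ^ n) \<in> H"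
  have "lgcd p H \<le> ereal r" for r
  proof -
    \<comment> \<open>Large enough that \<open>padic_val p x - int n\<close> is at most
      \<open>r\<close>; if the valuation of \<open>x\<close> is already that small,
      \<open>nat\<close> truncates to 0, which suffices.\<close>
    define n where "n = nat (padic_val p x - \<lfloor>r\<rfloor>)"
    obtain y where y: "y \<in> H - {0}" "padic_val p y \<le> padic_val p x - int n"
      using all div_prime_power_in_subgroup_iff[OF assms] by blast
    have "real_of_int (padic_val p y) \<le> r"
      using y(2) unfolding n_def by linarith
    then show ?thesis
      unfolding lgcd_def using y(1) by (intro INF_lower2[of y]) auto
  qed
  then show "lgcd p H = - \<infinity>" by (rule ereal_bot)
qed

text \<open>At primes where \<open>x\<close> has valuation 0, the presence of \<open>x\<close>
  forces \<open>lgcd p H \<le> 0\<close>, and a negative value means exactly that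
  \<open>x / p\<close> is in \<open>H\<close>. The remaining primes form the finite set
  \<open>E\<close>, which does not affect finiteness.\<close>

lemma finite_support_iff:
  assumes H: "subgroup H rational_group" and x: "x \<in> H" "x \<noteq> 0"
  shows "finite_support H \<longleftrightarrow> finite {p. prime p \<and> x / of_nat p \<in> H}"
proof -
  define E where "E = {p. prime p \<and> padic_val p x \<noteq> 0}"
  have E: "finite E" unfolding E_def using x(2) by (rule finite_padic_val_nonzero)
  have *: "lgcd p H \<noteq> 0 \<longleftrightarrow> x / of_nat p \<in> H" if p: "prime p" "padic_val p x = 0" for p
  proof -
    have "lgcd p H \<le> 0"
      unfolding lgcd_def using x p by (intro INF_lower2[of x]) (auto simp: zero_ereal_def)
    then have "lgcd p H \<noteq> 0 \<longleftrightarrow> lgcd p H < 0" by auto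
    also have "\<dots> \<longleftrightarrow> (\<exists>y\<in>H - {0}. padic_val p y < 0)"
      unfolding lgcd_def INF_less_iff by (simp add: zero_ereal_def)
    also have "\<dots> \<longleftrightarrow> (\<exists>y\<in>H - {0}. padic_val p y \<le> padic_val p x - int 1)"
      using p by (intro bex_cong) auto
    also have "\<dots> \<longleftrightarrow> x / of_nat p \<in> H"
      using div_prime_power_in_subgroup_iff[OF H x p(1), of 1] by simp
    finally show ?thesis .
  qed
  have "{p. prime p \<and> lgcd p H \<noteq> 0} \<union> E = {p. prime p \<and> x / of_nat p \<in> H} \<union> E"
    using * by (auto simp: E_def)
  then have "finite ({p. prime p \<and> lgcd p H \<noteq> 0} \<union> E) =
      finite ({p. prime p \<and> x / of_nat p \<in> H} \<union> E)" by simp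
  then show ?thesis
    using E by (simp add: finite_support_def)
qed

section \<open>Realization\<close>

lemma nonempty_subsets_finite: "finite (nonempty_subsets k)"
  by (rule finite_subset[of _ "Pow {1..k}"]) (auto simp: nonempty_subsets_def)

lemma max_infty_finite: "finite (max_infty k \<chi>)"
  by (rule finite_subset[OF _ nonempty_subsets_finite[of k]]) (auto simp: max_infty_def)

lemma max_infty_above:
  assumes "I \<in> nonempty_subsets k" "\<chi> I = INFTY"
  shows "\<exists>K\<in>max_infty k \<chi>. I \<subseteq> K"
proof -
  let ?A = "{J \<in> nonempty_subsets k. \<chi> J = INFTY}"
  have "finite ?A" using nonempty_subsets_finite by simp
  then obtain K where "K \<in> ?A" "I \<subseteq> K" "\<forall>J\<in>?A. K \<subseteq> J \<longrightarrow> K = J"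
    using finite_has_maximal2[of ?A I] assms by blast
  then show ?thesis by (intro bexI[of _ K]) (auto simp: max_infty_def)
qed

text \<open>For nonzero \<open>x\<close>, this is the intersection of \<open>G\<close> with
  \<open>x\<close> times the localization of the integers obtained by inverting the primes in
  \<open>P\<close>.\<close>

definition localized_at :: "rat set \<Rightarrow> rat \<Rightarrow> nat set \<Rightarrow> rat set" where
  "localized_at G x P = {y \<in> G. \<forall>p. prime p \<longrightarrow> p dvd denom (y / x) \<longrightarrow> p \<in> P}"

lemma subgroup_localized_at:
  assumes G: "subgroup G rational_group"
  shows "subgroup (localized_at G x P) rational_group"
  unfolding subgroup_rational_group_iff
proof (intro conjI ballI)
  show "0 \<in> localized_at G x P"
    using subgroup_zero[OF G] by (auto simp: localized_at_def)
  fix y z assume yz: "y \<in> localized_at G x P" "z \<in> localized_at G x P"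
  have "p \<in> P" if p: "prime p" "p dvd denom ((y - z) / x)" for p
  proof -
    have "p dvd denom (y / x) * denom (z / x)"
      using p(2) denom_diff_dvd[of "y / x" "z / x"] dvd_trans by (simp add: diff_divide_distrib) blast
    then have "p dvd denom (y / x) \<or> p dvd denom (z / x)"
      using p(1) by (simp add: prime_dvd_mult_iff)
    with p(1) yz show ?thesis by (auto simp: localized_at_def)
  qed
  then show "y - z \<in> localized_at G x P"
    using yz subgroup_diff[OF G] by (auto simp: localized_at_def)
qed

text \<open>The condition on \<open>y\<close> is imposed prime by prime, so intersecting subgroups
  amounts to intersecting sets of allowed primes.\<close>

lemma localized_at_Inter:
  assumes "I \<noteq> {}"
  shows "(\<Inter>i\<in>I. localized_at G x (P i)) = localized_at G x (\<Inter>i\<in>I. P i)"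
  using assms by (auto simp: localized_at_def)

lemma divisors_at_localized_at:
  assumes "x \<noteq> 0"
  shows "divisors_at (localized_at G x P) x =
    {d \<in> divisors_at G x. \<forall>p. prime p \<longrightarrow> p dvd d \<longrightarrow> p \<in> P}"
  using assms by (auto simp: divisors_at_def localized_at_def denom_inverse_of_nat)

text \<open>Every \<open>d\<close> other than 1 has a prime factor, so only the divisor 1
  survives.\<close>

lemma finitely_generated_localized_at_empty:
  assumes G: "subgroup G rational_group" and x: "x \<in> G" "x \<noteq> 0"
  shows "finitely_generated rational_group (localized_at G x {})"
proof -
  have "x \<in> localized_at G x {}" using x by (auto simp: localized_at_def)
  moreover have "divisors_at (localized_at G x {}) x \<subseteq> {1}"
    using prime_factor_nat by (auto simp: divisors_at_localized_at[OF x(2)])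
  ultimately show ?thesis
    using finitely_generated_iff[OF subgroup_localized_at[OF G] _ x(2)] finite_subset by blast
qed

lemma realizable_rational_iff:
  assumes G: "subgroup G rational_group"
  shows "realizable (rational_group\<lparr>carrier := G\<rparr>) k \<chi> \<longleftrightarrow>
    (\<exists>H. (\<forall>i\<in>{1..k}. subgroup (H i) rational_group \<and> H i \<subseteq> G) \<and>
      (\<forall>I\<in>nonempty_subsets k.
        \<chi> I = FG \<longleftrightarrow> finitely_generated rational_group (\<Inter>i\<in>I. H i)))"
proof -
  have "((\<chi> I = FG \<longrightarrow> finitely_generated (rational_group\<lparr>carrier := G\<rparr>) (\<Inter>i\<in>I. H i)) \<and>
      (\<chi> I = INFTY \<longrightarrow> \<not> finitely_generated (rational_group\<lparr>carrier := G\<rparr>) (\<Inter>i\<in>I. H i))) \<longleftrightarrow>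
      (\<chi> I = FG \<longleftrightarrow> finitely_generated rational_group (\<Inter>i\<in>I. H i))"
    if H: "\<forall>i\<in>{1..k}. subgroup (H i) rational_group \<and> H i \<subseteq> G" and I: "I \<in> nonempty_subsets k"
    for H :: "nat \<Rightarrow> rat set" and I
  proof -
    have "(\<Inter>i\<in>I. H i) \<subseteq> G" using H I by (auto simp: nonempty_subsets_def)
    then show ?thesis
      using finitely_generated_carrier_update[OF G] by (cases "\<chi> I") auto
  qed
  then show ?thesis
    unfolding realizable_def subgroup_carrier_update_iff[OF G]
    by (intro arg_cong[of _ _ Ex] ext conj_cong ball_cong refl) blast
qed

text \<open>Isolates what both cases of the sufficiency proof share: they differ only in the choice
  of \<open>Q\<close>, and \<open>inf\<close> guarantees that each \<open>Q K\<close> alone already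
  destroys finite generation.\<close>

lemma realizable_if_disjoint_primes:
  assumes G: "subgroup G rational_group" and x: "x \<in> G" "x \<noteq> 0"
    and dec: "decreasing k \<chi>"
    and disj: "\<And>K L. K \<in> max_infty k \<chi> \<Longrightarrow> L \<in> max_infty k \<chi> \<Longrightarrow> K \<noteq> L \<Longrightarrow> Q K \<inter> Q L = {}"
    and inf: "\<And>K. K \<in> max_infty k \<chi> \<Longrightarrow> infinite (divisors_at (localized_at G x (Q K)) x)"
  shows "realizable (rational_group\<lparr>carrier := G\<rparr>) k \<chi>"
proof -
  define P where "P i = (\<Union>K\<in>{K \<in> max_infty k \<chi>. i \<in> K}. Q K)" for i
  define H where "H i = localized_at G x (P i)" for i
  have "\<chi> I = FG \<longleftrightarrow> finitely_generated rational_group (\<Inter>i\<in>I. H i)"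
    if I: "I \<in> nonempty_subsets k" for I
  proof -
    have ne: "I \<noteq> {}" using I by (simp add: nonempty_subsets_def)
    have HI: "(\<Inter>i\<in>I. H i) = localized_at G x (\<Inter>i\<in>I. P i)"
      unfolding H_def by (rule localized_at_Inter[OF ne])
    show ?thesis
    proof (cases "\<chi> I")
      case FG
      \<comment> \<open>By disjointness, a common \<open>p\<close> belongs to only one
        \<open>Q K\<close>, so every index of \<open>I\<close> lies in that \<open>K\<close>.
        Monotonicity would then give \<open>\<chi> I = INFTY\<close>.\<close>
      have "(\<Inter>i\<in>I. P i) = {}"
      proof (rule ccontr)
        assume "(\<Inter>i\<in>I. P i) \<noteq> {}"
        then obtain p where p: "\<And>i. i \<in> I \<Longrightarrow> p \<in> P i" by blast
        from ne obtain i where "i \<in> I" by blast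
        with p obtain K where K: "K \<in> max_infty k \<chi>" "p \<in> Q K" unfolding P_def by blast
        have "I \<subseteq> K"
        proof
          fix j assume "j \<in> I"
          then obtain L where "L \<in> max_infty k \<chi>" "p \<in> Q L" "j \<in> L"
            using p unfolding P_def by blast
          with disj[of K L] K show "j \<in> K" by blast
        qed
        with dec I K have "\<chi> K \<le> \<chi> I" unfolding decreasing_def max_infty_def by blast
        with K FG show False by (simp add: max_infty_def less_eq_fin_symbol_def)
      qed
      then show ?thesis
        using FG HI finitely_generated_localized_at_empty[OF G x] by simp
    next
      case INFTY
      obtain K where K: "K \<in> max_infty k \<chi>" "I \<subseteq> K"
        using max_infty_above[where \<chi> = \<chi>, OF I INFTY] by blast
      then have "localized_at G x (Q K) \<subseteq> (\<Inter>i\<in>I. H i)"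
        unfolding HI unfolding localized_at_def P_def by blast
      then have "infinite (divisors_at (\<Inter>i\<in>I. H i) x)"
        using inf[OF K(1)] divisors_at_mono finite_subset by metis
      moreover have "x \<in> (\<Inter>i\<in>I. H i)"
        unfolding HI using x by (auto simp: localized_at_def)
      moreover have "subgroup (\<Inter>i\<in>I. H i) rational_group"
        unfolding HI by (rule subgroup_localized_at[OF G])
      ultimately show ?thesis
        using INFTY finitely_generated_iff[OF _ _ x(2)] by simp
    qed
  qed
  moreover have "subgroup (H i) rational_group \<and> H i \<subseteq> G" for i
    using subgroup_localized_at[OF G] by (auto simp: H_def localized_at_def)
  ultimately show ?thesis
    unfolding realizable_rational_iff[OF G] by blast
qed

text \<open>Any two nonzero rationals have a common nonzero integer multiple:
  \<open>z / y = a / d\<close> gives \<open>d z = a y\<close>.\<close>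

lemma subgroup_Int_nontrivial:
  assumes H: "subgroup H rational_group" "H \<noteq> {0}" and K: "subgroup K rational_group" "K \<noteq> {0}"
  obtains x where "x \<in> H" "x \<in> K" "x \<noteq> 0"
proof -
  obtain y where y: "y \<in> H" "y \<noteq> 0" using H subgroup_zero[OF H(1)] by blast
  obtain z where z: "z \<in> K" "z \<noteq> 0" using K subgroup_zero[OF K(1)] by blast
  define d where "d = denom (z / y)"
  obtain a where a: "z / y = of_int a / of_nat d"
    unfolding d_def by (rule denom_quotient)
  have d: "(of_nat d :: rat) \<noteq> 0" using denom_pos[of "z / y"] by (simp add: d_def)
  have "of_nat d * z = of_int a * y"
    using a y d by (simp add: field_simps)
  then have "of_nat d * z \<in> H"
    using subgroup_of_int_mult[OF H(1) y(1), of a] by simp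
  moreover have "of_nat d * z \<noteq> 0" using d z by simp
  ultimately show thesis
    using that subgroup_of_nat_mult[OF K(1) z(1)] by blast
qed

theorem corollary5p13:
  fixes G :: "rat set" and k :: nat and \<chi> :: config
  assumes "subgroup G rational_group"
    and "G \<noteq> {0}"
    and "k \<ge> 1"
  shows "realizable (rational_group\<lparr>carrier := G\<rparr>) k \<chi> \<longleftrightarrow>
    decreasing k \<chi> \<and>
    (finite_support G \<longrightarrow> card (max_infty k \<chi>) \<le> card (supp_minf G))"
proof (intro iffI conjI impI)
  note G = assms(1)
  assume "realizable (rational_group\<lparr>carrier := G\<rparr>) k \<chi>"
  then obtain H where H: "\<And>i. i \<in> {1..k} \<Longrightarrow> subgroup (H i) rational_group"
    and HG: "\<And>i. i \<in> {1..k} \<Longrightarrow> H i \<subseteq> G"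
    and \<chi>: "\<And>I. I \<in> nonempty_subsets k \<Longrightarrow>
      \<chi> I = FG \<longleftrightarrow> finitely_generated rational_group (\<Inter>i\<in>I. H i)"
    unfolding realizable_rational_iff[OF G] by blast
  have sub: "subgroup (\<Inter>i\<in>I. H i) rational_group" if "I \<in> nonempty_subsets k" for I
    using that H by (intro subgroup_rational_Inter) (auto simp: nonempty_subsets_def)
  have subG: "(\<Inter>i\<in>I. H i) \<subseteq> G" if "I \<in> nonempty_subsets k" for I
    using that HG unfolding nonempty_subsets_def by blast
  show "decreasing k \<chi>"
    unfolding decreasing_def
  proof (intro ballI impI)
    fix I J assume IJ: "I \<in> nonempty_subsets k" "J \<in> nonempty_subsets k" "I \<subseteq> J"
    then have "(\<Inter>i\<in>J. H i) \<subseteq> (\<Inter>i\<in>I. H i)" by blast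
    then have "\<chi> I = FG \<Longrightarrow> \<chi> J = FG"
      using finitely_generated_subgroup[OF sub sub] \<chi> IJ by blast
    then show "\<chi> J \<le> \<chi> I"
      by (cases "\<chi> I") (auto simp: less_eq_fin_symbol_def)
  qed
  assume fs: "finite_support G"
  \<comment> \<open>Finite support bounds the primes dividing a base point, so an infinite divisor
    set must contain all powers of a single prime. That prime is inherited by
    \<open>G\<close>.\<close>
  have "\<exists>p. prime p \<and> lgcd p (\<Inter>i\<in>I. H i) = - \<infinity> \<and> p \<in> supp_minf G"
    and nontriv: "(\<Inter>i\<in>I. H i) \<noteq> {0}" if I: "I \<in> max_infty k \<chi>" for I
  proof -
    let ?K = "\<Inter>i\<in>I. H i"
    have Ik: "I \<in> nonempty_subsets k" and nfg: "\<not> finitely_generated rational_group ?K"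
      using I \<chi>[of I] by (auto simp: max_infty_def)
    show ne: "?K \<noteq> {0}" using nfg finitely_generated_zero by metis
    then obtain x where x: "x \<in> ?K" "x \<noteq> 0" using subgroup_zero[OF sub[OF Ik]] by blast
    have xG: "x \<in> G" using x subG[OF Ik] by blast
    have "infinite (divisors_at ?K x)"
      using nfg finitely_generated_iff[OF sub[OF Ik] x] by simp
    moreover have "finite {p. prime p \<and> x / of_nat p \<in> ?K}"
      using fs unfolding finite_support_iff[OF G xG x(2)]
      by (rule finite_subset[rotated]) (use subG[OF Ik] in blast)
    ultimately obtain p where p: "prime p" "\<And>n. x / of_nat (p ^ n) \<in> ?K"
      using infinite_divisors_at_imp_prime[OF sub[OF Ik]] by blast
    then have "lgcd p ?K = - \<infinity>" "lgcd p G = - \<infinity>"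
      using lgcd_eq_minf_iff[OF sub[OF Ik] x p(1)] lgcd_eq_minf_iff[OF G xG x(2) p(1)] subG[OF Ik]
      by blast+
    with p(1) show "\<exists>p. prime p \<and> lgcd p ?K = - \<infinity> \<and> p \<in> supp_minf G"
      by (auto simp: supp_minf_def)
  qed
  then obtain f where f: "\<And>I. I \<in> max_infty k \<chi> \<Longrightarrow> prime (f I)"
    "\<And>I. I \<in> max_infty k \<chi> \<Longrightarrow> lgcd (f I) (\<Inter>i\<in>I. H i) = - \<infinity>"
    "\<And>I. I \<in> max_infty k \<chi> \<Longrightarrow> f I \<in> supp_minf G"
    by metis
  have "inj_on f (max_infty k \<chi>)"
  proof (rule inj_onI, rule ccontr)
    fix I J assume I: "I \<in> max_infty k \<chi>" and J: "J \<in> max_infty k \<chi>"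
      and eq: "f I = f J" and ne: "I \<noteq> J"
    have k: "I \<in> nonempty_subsets k" "J \<in> nonempty_subsets k"
      using I J by (auto simp: max_infty_def)
    then have IJ: "I \<union> J \<in> nonempty_subsets k" by (auto simp: nonempty_subsets_def)
    have inter: "(\<Inter>i\<in>I \<union> J. H i) = (\<Inter>i\<in>I. H i) \<inter> (\<Inter>i\<in>J. H i)" by blast
    \<comment> \<open>Maximality of both sets would force each to equal the union.\<close>
    have "\<chi> (I \<union> J) \<noteq> INFTY"
    proof
      assume "\<chi> (I \<union> J) = INFTY"
      with I J IJ have "I \<union> J = I" "I \<union> J = J" unfolding max_infty_def by blast+
      with ne show False by simp
    qed
    then have "finitely_generated rational_group (\<Inter>i\<in>I \<union> J. H i)"
      using \<chi>[OF IJ] by (cases "\<chi> (I \<union> J)") auto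
    \<comment> \<open>A common base point lets both valuations of minus infinity speak about the
      same elements \<open>x / p ^ n\<close>, which then lie in the intersection over the
      union.\<close>
    moreover obtain x where x: "x \<in> (\<Inter>i\<in>I. H i)" "x \<in> (\<Inter>i\<in>J. H i)" "x \<noteq> 0"
      using subgroup_Int_nontrivial[OF sub[OF k(1)] nontriv[OF I] sub[OF k(2)] nontriv[OF J]] .
    moreover have "x / of_nat (f I ^ n) \<in> (\<Inter>i\<in>I \<union> J. H i)" for n
      unfolding inter
      using lgcd_eq_minf_iff[OF sub[OF k(1)] x(1,3) f(1)[OF I]] f(2)[OF I]
        lgcd_eq_minf_iff[OF sub[OF k(2)] x(2,3) f(1)[OF J]] f(2)[OF J] eq
      by auto
    then have "infinite (divisors_at (\<Inter>i\<in>I \<union> J. H i) x)"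
      by (rule infinite_divisors_at_powers[OF f(1)[OF I]])
    ultimately show False
      using finitely_generated_iff[OF sub[OF IJ], of x] unfolding inter by blast
  qed
  \<comment> \<open>An infinite set has \<open>card\<close> 0, so the injection bounds cardinalities
    only once this is known.\<close>
  moreover have "finite (supp_minf G)"
    using fs unfolding finite_support_def supp_minf_def
    by (rule finite_subset[rotated]) auto
  ultimately show "card (max_infty k \<chi>) \<le> card (supp_minf G)"
    using f(3) by (intro card_inj_on_le[of f]) auto
next
  note G = assms(1)
  assume "decreasing k \<chi> \<and> (finite_support G \<longrightarrow> card (max_infty k \<chi>) \<le> card (supp_minf G))"
  then have dec: "decreasing k \<chi>"
    and card: "finite_support G \<Longrightarrow> card (max_infty k \<chi>) \<le> card (supp_minf G)"
    by auto
  obtain x where x: "x \<in> G" "x \<noteq> 0" using assms(2) subgroup_zero[OF G] by blast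
  show "realizable (rational_group\<lparr>carrier := G\<rparr>) k \<chi>"
  proof (cases "finite_support G")
    case True
    have "finite (supp_minf G)"
      using True unfolding finite_support_def supp_minf_def
      by (rule finite_subset[rotated]) auto
    then obtain f where f: "f ` max_infty k \<chi> \<subseteq> supp_minf G" "inj_on f (max_infty k \<chi>)"
      using card_le_inj[OF max_infty_finite _ card[OF True]] by blast
    show ?thesis
    proof (rule realizable_if_disjoint_primes[OF G x dec, where Q = "\<lambda>K. {f K}"])
      show "{f K} \<inter> {f L} = {}" if "K \<in> max_infty k \<chi>" "L \<in> max_infty k \<chi>" "K \<noteq> L" for K L
        using f(2) that by (auto dest: inj_onD)
      fix K assume "K \<in> max_infty k \<chi>"
      with f(1) have p: "prime (f K)" "lgcd (f K) G = - \<infinity>" by (auto simp: supp_minf_def)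
      \<comment> \<open>Relative to \<open>x\<close>, these elements have \<open>f K\<close> as the
        only possible prime in the denominator, so all of them survive in the localization at
        \<open>{f K}\<close>.\<close>
      have "denom (x / of_nat (f K ^ n) / x) = f K ^ n" for n
        using denom_inverse_of_nat[of "f K ^ n"] prime_gt_0_nat[OF p(1)] x by simp
      moreover have "q = f K" if "prime q" "q dvd f K ^ n" for q n
        using that p(1) by (metis prime_dvd_power primes_dvd_imp_eq)
      moreover have "x / of_nat (f K ^ n) \<in> G" for n
        using p lgcd_eq_minf_iff[OF G x p(1)] by blast
      ultimately have "x / of_nat (f K ^ n) \<in> localized_at G x {f K}" for n
        by (simp only: localized_at_def mem_Collect_eq singleton_iff) blast
      then show "infinite (divisors_at (localized_at G x {f K}) x)"
        by (rule infinite_divisors_at_powers[OF p(1)])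
    qed
  next
    case False
    then have "infinite {p. prime p \<and> x / of_nat p \<in> G}"
      using finite_support_iff[OF G x] by simp
    \<comment> \<open>Infinitely many usable primes contain a sequence of disjoint infinite sets;
      the injection \<open>g\<close> below gives each maximal set its own one.\<close>
    then obtain C :: "nat \<Rightarrow> nat set" where C: "pairwise (\<lambda>i j. disjnt (C i) (C j)) UNIV"
      "(\<Union>i. C i) \<subseteq> {p. prime p \<and> x / of_nat p \<in> G}" "\<And>i. infinite (C i)"
      by (rule infinite_infinite_partition) blast
    obtain g :: "nat set \<Rightarrow> nat" where g: "inj_on g (max_infty k \<chi>)"
      using finite_imp_inj_to_nat_seg[OF max_infty_finite] by blast
    show ?thesis
    proof (rule realizable_if_disjoint_primes[OF G x dec, where Q = "\<lambda>K. C (g K)"])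
      show "C (g K) \<inter> C (g L) = {}" if "K \<in> max_infty k \<chi>" "L \<in> max_infty k \<chi>" "K \<noteq> L" for K L
        using C(1) g that by (auto simp: pairwise_def disjnt_def dest: inj_onD)
      fix K
      \<comment> \<open>Here infinity comes from many distinct primes, each to the first power,
        instead of from powers of one prime.\<close>
      have "C (g K) \<subseteq> divisors_at (localized_at G x (C (g K))) x"
        unfolding divisors_at_localized_at[OF x(2)]
      proof
        fix d assume d: "d \<in> C (g K)"
        with C(2) have "prime d" "x / of_nat d \<in> G" by blast+
        moreover have "p = d" if "prime p" "p dvd d" for p
          using that \<open>prime d\<close> primes_dvd_imp_eq by blast
        ultimately show "d \<in> {d \<in> divisors_at G x. \<forall>p. prime p \<longrightarrow> p dvd d \<longrightarrow> p \<in> C (g K)}"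
          using d by (auto simp: divisors_at_def prime_gt_0_nat)
      qed
      then show "infinite (divisors_at (localized_at G x (C (g K))) x)"
        using C(3) finite_subset by blast
    qed
  qed
qed

end
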